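(* Let $\mathbf{P}$ be a noun system, let $\Gamma$ be a set of sentences of $\mathcal{L}(\mathbf{P})$ and let $\varphi$ be a sentence of $\mathcal{L}(\mathbf{P})$. If $\Gamma\vdash\varphi$, then $\Gamma\models\varphi$, i.e. every model (with infinite universe) in which all sentences of $\Gamma$ are true also makes $\varphi$ true.
   Context: Syntax. A noun system $\mathbf{P}=(P,\overline{\phantom{p}})$ is a set $P$ of nouns with an operation $p\mapsto\overline{p}$ on $P$ satisfying $\overline{\overline{p}}=p$. The sentences of $\mathcal{L}(\mathbf{P})$ are $\forall(p,q)$, $\exists(p,q)$, $\exists^{\geq}(p,q)$, $\exists^{>}(p,q)$ for $p,q\in P$. There are no connectives. Semantics. A model $\mathcal{M}$ is a set $M$ with a map $[\![\ ]\!]:P\to\mathcal{P}(M)$ (the power set of $M$) such that $[\![\overline{p}]\!]=M\setminus[\![p]\!]$ for all $p$. All models are assumed to have infinite universe $M$ (the sets $[\![p]\!]$ may be finite or empty). Truth: $\mathcal{M}\models\forall(p,q)$ iff $[\![p]\!]\subseteq[\![q]\!]$; $\mathcal{M}\models\exists(p,q)$ iff $[\![p]\!]\cap[\![q]\!]\neq\emptyset$; $\mathcal{M}\models\exists^{\geq}(p,q)$ iff $|[\![p]\!]|\geq|[\![q]\!]|$; $\mathcal{M}\models\exists^{>}(p,q)$ iff $|[\![p]\!]|>|[\![q]\!]|$. Proof system. $\Gamma\vdash\varphi$ means that there is a finite tree with root labelled $\varphi$, each node of which is either a leaf labelled by an element of $\Gamma$ or is obtained from its children by one of the following rules (premises $\Rightarrow$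 conclusion; $n,p,q,x$ arbitrary nouns, $\varphi$ an arbitrary sentence): (axiom) $\Rightarrow\forall(p,p)$; (barbara) $\forall(n,p),\forall(p,q)\Rightarrow\forall(n,q)$; (some) $\exists(p,q)\Rightarrow\exists(p,p)$; (conversion) $\exists(q,p)\Rightarrow\exists(p,q)$; (darii) $\exists(p,n),\forall(n,q)\Rightarrow\exists(p,q)$; (anti) $\forall(p,q)\Rightarrow\forall(\overline{q},\overline{p})$; (zero) $\forall(p,\overline{p})\Rightarrow\forall(p,q)$; (one) $\forall(\overline{p},p)\Rightarrow\forall(q,p)$; (subset-size) $\forall(p,q)\Rightarrow\exists^{\geq}(q,p)$; (card-trans) $\exists^{\geq}(n,p),\exists^{\geq}(p,q)\Rightarrow\exists^{\geq}(n,q)$; (card-$\exists$) $\exists(p,p),\exists^{\geq}(q,p)\Rightarrow\exists(q,q)$; (more-at least) $\exists^{>}(p,q)\Rightarrow\exists^{\geq}(p,q)$; (more-left) $\exists^{>}(n,p),\exists^{\geq}(p,q)\Rightarrow\exists^{>}(n,q)$; (more-right) $\exists^{\geq}(n,p),\exists^{>}(p,q)\Rightarrow\exists^{>}(n,q)$; (more-some) $\exists^{>}(p,q)\Rightarrow\exists(p,\overline{q})$; (x) $\exists(p,q),\forall(q,\overline{q})\Rightarrow\varphi$; (x-card) $\exists^{>}(p,q),\exists^{\geq}(q,p)\Rightarrow\varphi$; (non-empty) $\exists^{\geq}(p,\overline{p})\Rightarrow\exists(p,p)$; (non-empty-more) $\forall(\overline{p},p)\Rightarrow\exists^{>}(p,\overline{p})$;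 (weak-more-anti) $\exists^{>}(q,p)\Rightarrow\exists^{\geq}(\overline{p},x)$; (up) $\exists^{\geq}(x,p),\exists^{\geq}(x,\overline{p})\Rightarrow\exists^{\geq}(x,q)$. *)

theory Defs
  imports "HOL-Library.Equipollence"
begin

locale noun_system =
  fixes P :: "'p set" and bar :: "'p \<Rightarrow> 'p"
  assumes bar_closed: "p \<in> P \<Longrightarrow> bar p \<in> P"
    and bar_bar: "p \<in> P \<Longrightarrow> bar (bar p) = p"

text \<open>\<open>AtLeast p q\<close> is the sentence ``there are at least as many \<open>p\<close> as \<open>q\<close>'' and \<open>More p q\<close> is
  ``there are more \<open>p\<close> than \<open>q\<close>''.\<close>

datatype 'p sentence =
    All 'p 'p
  | Exists 'p 'p
  | AtLeast 'p 'p
  | More 'p 'p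

definition sentences :: "'p set \<Rightarrow> 'p sentence set" where
  "sentences P = {\<phi>. set_sentence \<phi> \<subseteq> P}"

locale model = noun_system P bar
  for P :: "'p set" and bar :: "'p \<Rightarrow> 'p" +
  fixes M :: "'m set" and I :: "'p \<Rightarrow> 'm set"
  assumes infinite_universe: "infinite M"
    and interp_subset: "p \<in> P \<Longrightarrow> I p \<subseteq> M"
    and interp_bar: "p \<in> P \<Longrightarrow> I (bar p) = M - I p"

primrec holds :: "('p \<Rightarrow> 'm set) \<Rightarrow> 'p sentence \<Rightarrow> bool" where
  "holds I (All p q) \<longleftrightarrow> I p \<subseteq> I q"
| "holds I (Exists p q) \<longleftrightarrow> I p \<inter> I q \<noteq> {}"
| "holds I (AtLeast p q) \<longleftrightarrow> I q \<lesssim> I p"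
| "holds I (More p q) \<longleftrightarrow> I q \<prec> I p"

text \<open>The type argument fixes the type from which universes are drawn, since a definition
  cannot quantify over types; leaving it a type variable in a theorem covers all models.\<close>

definition entails ::
  "'p set \<Rightarrow> ('p \<Rightarrow> 'p) \<Rightarrow> 'm itself \<Rightarrow> 'p sentence set \<Rightarrow> 'p sentence \<Rightarrow> bool" where
  "entails P bar (_ :: 'm itself) \<Gamma> \<phi> \<longleftrightarrow>
     (\<forall>(M :: 'm set) I. model P bar M I \<longrightarrow> (\<forall>\<psi>\<in>\<Gamma>. holds I \<psi>) \<longrightarrow> holds I \<phi>)"

text \<open>Membership in \<open>P\<close> is required only of nouns and sentences that a rule introduces freely;
  for the others it is inherited from the premises when \<open>\<Gamma> \<subseteq> sentences P\<close>
  (lemma \<open>derivable_in_sentences\<close>).\<close>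

inductive derivable ::
  "'p set \<Rightarrow> ('p \<Rightarrow> 'p) \<Rightarrow> 'p sentence set \<Rightarrow> 'p sentence \<Rightarrow> bool"
  for P :: "'p set" and bar :: "'p \<Rightarrow> 'p" and \<Gamma> :: "'p sentence set" where
  leaf: "\<phi> \<in> \<Gamma> \<Longrightarrow> derivable P bar \<Gamma> \<phi>"
| axiom: "p \<in> P \<Longrightarrow> derivable P bar \<Gamma> (All p p)"
| barbara: "derivable P bar \<Gamma> (All n p) \<Longrightarrow> derivable P bar \<Gamma> (All p q)
    \<Longrightarrow> derivable P bar \<Gamma> (All n q)"
| some: "derivable P bar \<Gamma> (Exists p q) \<Longrightarrow> derivable P bar \<Gamma> (Exists p p)"
| conversion: "derivable P bar \<Gamma> (Exists q p) \<Longrightarrow> derivable P bar \<Gamma> (Exists p q)"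
| darii: "derivable P bar \<Gamma> (Exists p n) \<Longrightarrow> derivable P bar \<Gamma> (All n q)
    \<Longrightarrow> derivable P bar \<Gamma> (Exists p q)"
| anti: "derivable P bar \<Gamma> (All p q) \<Longrightarrow> derivable P bar \<Gamma> (All (bar q) (bar p))"
| zero: "derivable P bar \<Gamma> (All p (bar p)) \<Longrightarrow> q \<in> P \<Longrightarrow> derivable P bar \<Gamma> (All p q)"
| one: "derivable P bar \<Gamma> (All (bar p) p) \<Longrightarrow> q \<in> P \<Longrightarrow> derivable P bar \<Gamma> (All q p)"
| subset_size: "derivable P bar \<Gamma> (All p q) \<Longrightarrow> derivable P bar \<Gamma> (AtLeast q p)"
| card_trans: "derivable P bar \<Gamma> (AtLeast n p) \<Longrightarrow> derivable P bar \<Gamma> (AtLeast p q)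
    \<Longrightarrow> derivable P bar \<Gamma> (AtLeast n q)"
| card_exists: "derivable P bar \<Gamma> (Exists p p) \<Longrightarrow> derivable P bar \<Gamma> (AtLeast q p)
    \<Longrightarrow> derivable P bar \<Gamma> (Exists q q)"
| more_at_least: "derivable P bar \<Gamma> (More p q) \<Longrightarrow> derivable P bar \<Gamma> (AtLeast p q)"
| more_left: "derivable P bar \<Gamma> (More n p) \<Longrightarrow> derivable P bar \<Gamma> (AtLeast p q)
    \<Longrightarrow> derivable P bar \<Gamma> (More n q)"
| more_right: "derivable P bar \<Gamma> (AtLeast n p) \<Longrightarrow> derivable P bar \<Gamma> (More p q)
    \<Longrightarrow> derivable P bar \<Gamma> (More n q)"
| more_some: "derivable P bar \<Gamma> (More p q) \<Longrightarrow> derivable P bar \<Gamma> (Exists p (bar q))"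
| x: "derivable P bar \<Gamma> (Exists p q) \<Longrightarrow> derivable P bar \<Gamma> (All q (bar q))
    \<Longrightarrow> \<phi> \<in> sentences P \<Longrightarrow> derivable P bar \<Gamma> \<phi>"
| x_card: "derivable P bar \<Gamma> (More p q) \<Longrightarrow> derivable P bar \<Gamma> (AtLeast q p)
    \<Longrightarrow> \<phi> \<in> sentences P \<Longrightarrow> derivable P bar \<Gamma> \<phi>"
| non_empty: "derivable P bar \<Gamma> (AtLeast p (bar p)) \<Longrightarrow> derivable P bar \<Gamma> (Exists p p)"
| non_empty_more: "derivable P bar \<Gamma> (All (bar p) p) \<Longrightarrow> derivable P bar \<Gamma> (More p (bar p))"
| weak_more_anti: "derivable P bar \<Gamma> (More q p) \<Longrightarrow> x \<in> P
    \<Longrightarrow> derivable P bar \<Gamma> (AtLeast (bar p) x)"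
| up: "derivable P bar \<Gamma> (AtLeast x p) \<Longrightarrow> derivable P bar \<Gamma> (AtLeast x (bar p)) \<Longrightarrow> q \<in> P
    \<Longrightarrow> derivable P bar \<Gamma> (AtLeast x q)"

lemma (in noun_system) derivable_in_sentences:
  assumes "derivable P bar \<Gamma> \<phi>" and "\<Gamma> \<subseteq> sentences P"
  shows "\<phi> \<in> sentences P"
  using assms by (induction rule: derivable.induct) (auto simp: sentences_def bar_closed)

end

theory Submission
  imports Defs
begin

text \<open>Each rule preserves truth in a fixed model. Only \<open>weak_more_anti\<close> and \<open>up\<close> involve
  cardinal arithmetic: since the universe is infinite, any set dominating both a noun and its
  complement dominates the whole universe, and of any noun and its complement, one is
  equipollent to the universe.\<close>

text \<open>\<open>C\<close> cannot be finite, as otherwise \<open>A\<close>, \<open>B\<close> and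
  hence their union would be; and an infinite cardinal absorbs a union of two sets no larger than
  itself.\<close>

lemma Un_lepoll_infinite:
  includes cardinal_syntax
  assumes "infinite (A \<union> B)" "A \<lesssim> C" "B \<lesssim> C"
  shows "A \<union> B \<lesssim> C"
proof -
  have "infinite C"
    using assms inj_on_finite unfolding lepoll_def by blast
  moreover have "|A| \<le>o |C|" "|B| \<le>o |C|"
    using assms(2,3) by (auto simp: lepoll_def simp flip: card_of_ordLeq)
  ultimately have "|A \<union> B| \<le>o |C|"
    by (intro card_of_Un_ordLeq_infinite_Field card_of_Card_order) (auto simp: Field_card_of)
  then show ?thesis
    by (auto simp: lepoll_def simp flip: card_of_ordLeq)
qed

text \<open>\<open>A\<close> and \<open>M - A\<close> are comparable in size, and the larger of the
  two absorbs their union \<open>M\<close>. The hypothesis rules out that this is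
  \<open>A\<close>.\<close>

lemma lepoll_Diff_if_not_lepoll:
  assumes "infinite M" "A \<subseteq> M" "\<not> M \<lesssim> A"
  shows "M \<lesssim> M - A"
proof -
  have M: "A \<union> (M - A) = M"
    using assms(2) by blast
  have "\<not> M - A \<lesssim> A"
    using Un_lepoll_infinite[of A "M - A" A] assms(1,3) M by auto
  then have "A \<lesssim> M - A"
    using ordLeq_total[OF card_of_Well_order card_of_Well_order, of A "M - A"]
    by (auto simp: lepoll_def simp flip: card_of_ordLeq)
  then show ?thesis
    using Un_lepoll_infinite[of A "M - A" "M - A"] assms(1) M by auto
qed

text \<open>Induction on the derivation. Since \<open>interp_bar\<close> and
  \<open>interp_subset\<close> speak only of nouns in \<open>P\<close>, the cases that use them
  first recover membership in \<open>P\<close>, often from \<open>derivable_in_sentences\<close>;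
  this is where \<open>\<Gamma> \<subseteq> sentences P\<close> enters.\<close>

lemma (in model) soundness:
  assumes "derivable P bar \<Gamma> \<phi>" and \<Gamma>: "\<Gamma> \<subseteq> sentences P" "\<forall>\<psi>\<in>\<Gamma>. holds I \<psi>"
  shows "holds I \<phi>"
  using assms(1)
proof (induction rule: derivable.induct)
  case (anti p q)
  have "p \<in> P" "q \<in> P"
    using derivable_in_sentences[OF anti(1) \<Gamma>(1)] by (auto simp: sentences_def)
  then show ?case
    using anti by (auto simp: interp_bar)
next
  case (zero p q)
  have "p \<in> P"
    using derivable_in_sentences[OF zero(1) \<Gamma>(1)] by (auto simp: sentences_def)
  then show ?case
    using zero by (auto simp: interp_bar)
next
  case (one p q)
  have "p \<in> P"
    using derivable_in_sentences[OF one(1) \<Gamma>(1)] by (auto simp: sentences_def)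
  then show ?case
    using one interp_subset[of q] by (auto simp: interp_bar)
next
  case (more_some p q)
  have "p \<in> P" "q \<in> P"
    using derivable_in_sentences[OF more_some(1) \<Gamma>(1)] by (auto simp: sentences_def)
  \<comment> \<open>Inclusion would give an embedding back, and by Schroeder-Bernstein the two sets
    would be equipollent.\<close>
  moreover have "\<not> I p \<subseteq> I q"
    using more_some by (auto simp: lesspoll_def subset_imp_lepoll lepoll_antisym)
  ultimately show ?case
    using interp_subset[of p] by (auto simp: interp_bar)
next
  case (x p q \<phi>)
  have "q \<in> P"
    using derivable_in_sentences[OF x(1) \<Gamma>(1)] by (auto simp: sentences_def)
  then show ?case
    using x by (auto simp: interp_bar)
next
  case (non_empty p)
  have "p \<in> P"
    using derivable_in_sentences[OF non_empty(1) \<Gamma>(1)] by (auto simp: sentences_def)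
  \<comment> \<open>Were \<open>I p\<close> empty, its complement would be all of \<open>M\<close>,
    and an infinite set does not embed into the empty one.\<close>
  then show ?case
    using non_empty infinite_universe by (auto simp: interp_bar)
next
  case (non_empty_more p)
  have p: "p \<in> P"
    using derivable_in_sentences[OF non_empty_more(1) \<Gamma>(1)] by (auto simp: sentences_def)
  then have "I p = M"
    using non_empty_more interp_subset[of p] by (auto simp: interp_bar)
  moreover have "{} \<prec> M"
    using infinite_universe by (auto simp: finite_lesspoll_infinite)
  ultimately show ?case
    using p by (simp add: interp_bar)
next
  case (weak_more_anti q p x)
  have p: "p \<in> P" and q: "q \<in> P"
    using derivable_in_sentences[OF weak_more_anti(1) \<Gamma>(1)] by (auto simp: sentences_def)
  \<comment> \<open>\<open>I p\<close> is strictly smaller than \<open>I q\<close>, a subset of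
    \<open>M\<close>, so it falls short of full size; its complement must then have full size and
    dominate every noun.\<close>
  have "\<not> M \<lesssim> I p"
  proof
    assume "M \<lesssim> I p"
    then have "I q \<lesssim> I p"
      using interp_subset[OF q] subset_imp_lepoll lepoll_trans by blast
    then show False
      using weak_more_anti by (auto simp: lesspoll_def lepoll_antisym)
  qed
  then have "M \<lesssim> I (bar p)"
    using lepoll_Diff_if_not_lepoll infinite_universe interp_subset[OF p] p
    by (simp add: interp_bar)
  then show ?case
    using interp_subset[OF \<open>x \<in> P\<close>] by (auto intro: lepoll_trans subset_imp_lepoll)
next
  case (up x p q)
  have p: "p \<in> P"
    using derivable_in_sentences[OF up(1) \<Gamma>(1)] by (auto simp: sentences_def)
  have "I p \<union> I (bar p) = M"
    using interp_subset[OF p] interp_bar[OF p] by blast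
  then have "M \<lesssim> I x"
    using Un_lepoll_infinite[of "I p" "I (bar p)" "I x"] infinite_universe up by auto
  then show ?case
    using interp_subset[OF \<open>q \<in> P\<close>] by (auto intro: lepoll_trans subset_imp_lepoll)
next
  case (card_exists p q)
  then show ?case
    by (auto simp: lepoll_empty_iff_empty)
next
  case (x_card p q \<phi>)
  \<comment> \<open>The premises contradict each other by Schroeder-Bernstein.\<close>
  then show ?case
    by (auto simp: lesspoll_def lepoll_antisym)
\<comment> \<open>The remaining rules need only the truth of \<open>\<Gamma>\<close>, elementary set
  inclusions, and transitivity of \<open>\<lesssim>\<close> alone or mixed with
  \<open>\<prec>\<close>.\<close>
qed (use \<Gamma>(2) in \<open>auto intro: subset_imp_lepoll lepoll_trans lesspoll_trans1 lesspoll_trans2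
      lesspoll_imp_lepoll\<close>)

theorem proposition1p6:
  fixes P :: "'p set" and bar :: "'p \<Rightarrow> 'p"
    and \<Gamma> :: "'p sentence set" and \<phi> :: "'p sentence"
  assumes "noun_system P bar"
    and "\<Gamma> \<subseteq> sentences P"
    and "\<phi> \<in> sentences P"
    and "derivable P bar \<Gamma> \<phi>"
  shows "entails P bar TYPE('m) \<Gamma> \<phi>"
  using assms(2,4) by (auto simp: entails_def intro: model.soundness)

end
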